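(* For each diameter diminishing to zero iterated function system $\mathcal{S}=((X,d),(f_i)_{i\in I})$, we have $$\{a_{\dot{\omega}}\}=\mathrm{Fix}(f_\omega)$$ for each $\omega\in\Lambda^*(I)\smallsetminus\{\lambda\}$.
   Context: Metric spaces are nonempty. For a metric space $(X,d)$, $P_b(X)$ is the set of nonempty bounded subsets of $X$ and $P_{b,cl}(X)$ the set of nonempty bounded closed subsets. An iterated function system (IFS) is a pair $\mathcal{S}=((X,d),(f_i)_{i\in I})$ where $(X,d)$ is a complete metric space, $I$ is a nonempty finite set, each $f_i:X\to X$ is continuous, and $f_i(B)\in P_b(X)$ for every $B\in P_b(X)$ and $i\in I$. Its fractal operator $F_{\mathcal{S}}:P_{b,cl}(X)\to P_{b,cl}(X)$ is $F_{\mathcal{S}}(B)=\overline{\bigcup_{i\in I}f_i(B)}$. $\mathbb{N}^*=\{1,2,\dots\}$. $\Lambda(I)=I^{\mathbb{N}^*}$ is the set of infinite words $\omega=\omega_1\omega_2\dots$ over $I$; $\Lambda_n(I)$ is the set of words of length $n$ over $I$; $\lambda$ is the empty word, $\Lambda_0(I)=\{\lambda\}$, and $\Lambda^*(I)=\bigcup_{n\geq 0}\Lambda_n(I)$ is the set of all finite words. $[\omega]_n=\omega_1\dots\omega_n$ for $\omega\in\Lambda(I)$. For $\omega=\omega_1\dots\omega_n\in\Lambda_n(I)$ with $n\geq 1$: $f_\omega=f_{\omega_1}\circ\dots\circ f_{\omega_n}$, and $\dot{\omega}=\omega\omega\omega\dots\in\Lambda(I)$ is the infinite periodic word obtained by repeating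 $\omega$. $\mathrm{Fix}(g)$ denotes the set of fixed points of $g:X\to X$. An IFS $\mathcal{S}$ is diameter diminishing to zero if for every $B\in P_{b,cl}(X)$ there exists $M_B\in P_{b,cl}(X)$ such that $B\subseteq M_B$, $F_{\mathcal{S}}(M_B)\subseteq M_B$ and $\lim_{n\to\infty}\max_{\omega\in\Lambda_n(I)}\mathrm{diam}(f_\omega(M_B))=0$. For a diameter diminishing to zero IFS and $\omega\in\Lambda(I)$, $a_\omega\in X$ denotes the unique point (it exists) such that $\bigcap_{n\in\mathbb{N}^*}\overline{f_{[\omega]_n}(B)}=\{a_\omega\}$ for every $B\in P_{b,cl}(X)$ with $F_{\mathcal{S}}(B)\subseteq B$. *)

theory Defs
  imports "HOL-Analysis.Analysis" "HOL-Library.Stream"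
begin

text \<open>
  The metric space X is a type of class \<^class>\<open>metric_space\<close> (types are nonempty); the maps of a
  system are a family indexed by a set I, and only its members with index in I matter.
\<close>

definition P_b :: "'a::metric_space set set" where
  "P_b = {B. B \<noteq> {} \<and> bounded B}"

definition P_bcl :: "'a::metric_space set set" where
  "P_bcl = {B. B \<noteq> {} \<and> bounded B \<and> closed B}"

definition ifs :: "'i set \<Rightarrow> ('i \<Rightarrow> 'a::complete_space \<Rightarrow> 'a) \<Rightarrow> bool" where
  "ifs I f \<longleftrightarrow>
     finite I \<and> I \<noteq> {} \<and>
     (\<forall>i\<in>I. continuous_on UNIV (f i)) \<and>
     (\<forall>i\<in>I. \<forall>B\<in>P_b. f i ` B \<in> P_b)"

definition fractal_op :: "'i set \<Rightarrow> ('i \<Rightarrow> 'a::metric_space \<Rightarrow> 'a) \<Rightarrow> 'a set \<Rightarrow> 'a set" where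
  "fractal_op I f B = closure (\<Union>i\<in>I. f i ` B)"

text \<open>
  Finite words over I are the elements of \<^term>\<open>lists I\<close>, infinite words those of \<^term>\<open>streams I\<close>.
  The prefix of length n of an infinite word w is \<^term>\<open>stake n w\<close>, and the periodic word obtained
  by repeating a nonempty finite word w is \<^term>\<open>cycle w\<close>.
\<close>

definition words :: "nat \<Rightarrow> 'i set \<Rightarrow> 'i list set" where
  "words n I = {w \<in> lists I. length w = n}"

text \<open>The first letter of the word is the outermost map; the empty word gives the identity.\<close>

definition word_map :: "('i \<Rightarrow> 'a \<Rightarrow> 'a) \<Rightarrow> 'i list \<Rightarrow> 'a \<Rightarrow> 'a" where
  "word_map f w = foldr (\<circ>) (map f w) id"

definition Fix :: "('a \<Rightarrow> 'a) \<Rightarrow> 'a set" where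
  "Fix g = {x. g x = x}"

definition diam_diminishing :: "'i set \<Rightarrow> ('i \<Rightarrow> 'a::complete_space \<Rightarrow> 'a) \<Rightarrow> bool" where
  "diam_diminishing I f \<longleftrightarrow>
     ifs I f \<and>
     (\<forall>B\<in>P_bcl. \<exists>M\<in>P_bcl. B \<subseteq> M \<and> fractal_op I f M \<subseteq> M \<and>
        (\<lambda>n. Max ((\<lambda>w. diameter (word_map f w ` M)) ` words n I)) \<longlonglongrightarrow> 0)"

definition code_point :: "'i set \<Rightarrow> ('i \<Rightarrow> 'a::complete_space \<Rightarrow> 'a) \<Rightarrow> 'i stream \<Rightarrow> 'a" where
  "code_point I f w =
     (THE a. \<forall>B\<in>P_bcl. fractal_op I f B \<subseteq> B \<longrightarrow>
        (\<Inter>n\<in>{1..}. closure (word_map f (stake n w) ` B)) = {a})"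

end

theory Submission
  imports Defs
begin

text \<open>
  For an infinite word \<open>s\<close> and a nonempty bounded closed set \<open>B\<close> that the system maps into itself,
  call the closure of the image of \<open>B\<close> under the prefix of \<open>s\<close> of length \<open>n\<close> the \<open>n\<close>-th cell of
  \<open>s\<close> in \<open>B\<close>. The cells decrease in \<open>n\<close>, because every letter maps \<open>B\<close> into \<open>B\<close>, and when \<open>B\<close>
  is enlarged to one of the sets provided by \<^const>\<open>diam_diminishing\<close> their diameters tend to \<open>0\<close>.
  Cantor's intersection theorem then gives exactly one common point. It does not depend on \<open>B\<close>: two
  invariant sets lie in a common set with shrinking cells, whose single common point they must
  both have. This is the point that \<^const>\<open>code_point\<close> names (\<open>Inter_cells_eq_code_point\<close>).

  Let now \<open>s = www...\<close>, so that \<open>s\<close> is \<open>w\<close> followed by \<open>s\<close> itself. By continuity, the map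
  of \<open>w\<close> sends the \<open>n\<close>-th cell into the cell with index \<open>length w + n\<close>, hence back into the
  \<open>n\<close>-th cell. Thus it sends the code point to a point of all cells, which can only be the code
  point itself. Conversely, a fixed point of \<open>w\<close> in \<open>M\<close> is a fixed point of every power of \<open>w\<close>; these
  powers are the maps of prefixes of \<open>s\<close>, so infinitely many cells in \<open>M\<close> contain the point, and
  by monotonicity all of them do. So it equals the code point.
\<close>

section \<open>Maps of finite words\<close>

lemma word_map_Nil [simp]: "word_map f [] = id"
  by (simp add: word_map_def)

lemma word_map_Cons [simp]: "word_map f (i # w) = f i \<circ> word_map f w"
  by (simp add: word_map_def)

lemma word_map_append: "word_map f (v @ w) = word_map f v \<circ> word_map f w"
  by (induction v) (simp_all add: comp_assoc)

lemma continuous_on_word_map: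
  assumes "ifs I f" and "w \<in> lists I"
  shows "continuous_on UNIV (word_map f w)"
  using assms(2)
proof (induction w rule: lists.induct)
  case Nil
  then show ?case by (simp add: id_def)
next
  case (Cons i w)
  then show ?case
    using assms(1) continuous_on_compose2[of UNIV "f i" UNIV "word_map f w"]
    by (simp add: ifs_def comp_def)
qed

lemma image_subset_if_fractal_op_subset:
  assumes "fractal_op I f B \<subseteq> B"
  shows "\<forall>i\<in>I. f i ` B \<subseteq> B"
proof -
  have "(\<Union>i\<in>I. f i ` B) \<subseteq> B"
    using assms closure_subset unfolding fractal_op_def by (rule order_trans[rotated])
  then show ?thesis by blast
qed

lemma word_map_image_subset:
  assumes "\<forall>i\<in>I. f i ` B \<subseteq> B" and "w \<in> lists I"
  shows "word_map f w ` B \<subseteq> B"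
  using assms(2)
proof (induction w rule: lists.induct)
  case Nil
  then show ?case by simp
next
  case (Cons i w)
  then show ?case using assms(1) by fastforce
qed

lemma finite_words: "finite I \<Longrightarrow> finite (words n I)"
  using finite_lists_length_eq[of I n] by (simp add: words_def lists_eq_set)

section \<open>Cells of an infinite word\<close>

definition cell :: "('i \<Rightarrow> 'a::topological_space \<Rightarrow> 'a) \<Rightarrow> 'i stream \<Rightarrow> 'a set \<Rightarrow> nat \<Rightarrow> 'a set" where
  "cell f s B n = closure (word_map f (stake n s) ` B)"

lemma stake_in_words:
  assumes "s \<in> streams I"
  shows "stake n s \<in> words n I"
  using assms by (induction n arbitrary: s) (simp_all add: words_def streams_shd streams_stl)

lemma stake_in_lists: "s \<in> streams I \<Longrightarrow> stake n s \<in> lists I"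
  using stake_in_words[of s I n] by (simp add: words_def)

lemma cell_nonempty: "B \<noteq> {} \<Longrightarrow> cell f s B n \<noteq> {}"
  by (simp add: cell_def)

lemma cell_mono: "B \<subseteq> C \<Longrightarrow> cell f s B n \<subseteq> cell f s C n"
  by (simp add: cell_def closure_mono image_mono)

text \<open>
  Since letters are composed with the first one outermost, a longer prefix first maps \<open>B\<close> by its
  additional letters, which keeps it inside \<open>B\<close>.
\<close>

lemma cell_antimono:
  assumes "\<forall>i\<in>I. f i ` B \<subseteq> B" and "s \<in> streams I" and "m \<le> n"
  shows "cell f s B n \<subseteq> cell f s B m"
proof -
  have "sdrop m s \<in> streams I"
    using assms(2) by (simp add: streams_iff_snth sdrop_snth)
  then have tail: "word_map f (stake (n - m) (sdrop m s)) ` B \<subseteq> B"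
    by (intro word_map_image_subset[OF assms(1)] stake_in_lists)
  have "stake n s = stake m s @ stake (n - m) (sdrop m s)"
    using assms(3) by simp
  then have "word_map f (stake n s) ` B
      = word_map f (stake m s) ` word_map f (stake (n - m) (sdrop m s)) ` B"
    by (simp add: word_map_append image_comp del: stake_add)
  with tail show ?thesis
    unfolding cell_def by (simp add: closure_mono image_mono)
qed

lemma cells_shrink:
  assumes "finite I" and "bounded M" and "\<forall>i\<in>I. f i ` M \<subseteq> M" and "s \<in> streams I"
    and lim: "(\<lambda>n. Max ((\<lambda>w. diameter (word_map f w ` M)) ` words n I)) \<longlonglongrightarrow> 0"
    and "e > 0"
  shows "\<exists>n. \<forall>x\<in>cell f s M n. \<forall>y\<in>cell f s M n. dist x y < e"
proof -
  obtain n where n: "Max ((\<lambda>w. diameter (word_map f w ` M)) ` words n I) < e"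
    using order_tendstoD(2)[OF lim \<open>e > 0\<close>] by (auto simp: eventually_sequentially)
  have "word_map f (stake n s) ` M \<subseteq> M"
    by (intro word_map_image_subset[OF assms(3)] stake_in_lists[OF assms(4)])
  then have bounded: "bounded (word_map f (stake n s) ` M)"
    using assms(2) bounded_subset by blast
  have "diameter (word_map f (stake n s) ` M)
      \<le> Max ((\<lambda>w. diameter (word_map f w ` M)) ` words n I)"
    using finite_words[OF assms(1)] stake_in_words[OF assms(4)] by (intro Max_ge) auto
  with n have "diameter (cell f s M n) < e"
    unfolding cell_def by (simp add: diameter_closure[OF bounded])
  moreover have "bounded (cell f s M n)"
    unfolding cell_def using bounded by (rule bounded_closure)
  ultimately show ?thesis
    by (blast intro: le_less_trans diameter_bounded_bound)
qed

section \<open>The code point\<close>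

text \<open>
  The cells of \<open>B\<close> are contained in those of a larger invariant set whose cells shrink, and two
  distinct points cannot both stay in the latter.
\<close>

lemma common_point_of_cells_unique:
  assumes "diam_diminishing I f" and "s \<in> streams I" and "B \<in> P_bcl"
    and x: "\<And>n. n \<ge> 1 \<Longrightarrow> x \<in> cell f s B n" and y: "\<And>n. n \<ge> 1 \<Longrightarrow> y \<in> cell f s B n"
  shows "x = y"
proof (rule ccontr)
  assume "x \<noteq> y"
  obtain M where M: "M \<in> P_bcl" "B \<subseteq> M" "fractal_op I f M \<subseteq> M"
    "(\<lambda>n. Max ((\<lambda>w. diameter (word_map f w ` M)) ` words n I)) \<longlonglongrightarrow> 0"
    using assms(1,3) unfolding diam_diminishing_def by blast
  have inv: "\<forall>i\<in>I. f i ` M \<subseteq> M"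
    by (rule image_subset_if_fractal_op_subset[OF M(3)])
  have "finite I" "bounded M"
    using assms(1) M(1) by (auto simp: diam_diminishing_def ifs_def P_bcl_def)
  then obtain n where n: "\<forall>u\<in>cell f s M n. \<forall>v\<in>cell f s M n. dist u v < dist x y"
    using cells_shrink[OF _ _ inv assms(2) M(4), of "dist x y"] \<open>x \<noteq> y\<close> by auto
  \<comment> \<open>Only the cells with index at least 1 are known to contain the two points.\<close>
  have "cell f s B (Suc n) \<subseteq> cell f s M n"
    using cell_mono[OF M(2)] cell_antimono[OF inv assms(2), of n "Suc n"] by fastforce
  then have "x \<in> cell f s M n" "y \<in> cell f s M n"
    using x[of "Suc n"] y[of "Suc n"] by auto
  with n show False by blast
qed

text \<open>
  The cells of \<open>B\<close> shrink as well, being contained in those of a larger set with vanishing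
  diameters, so Cantor's intersection theorem applies to them.
\<close>

lemma ex_common_point_of_cells:
  assumes "diam_diminishing I f" and "s \<in> streams I"
    and "B \<in> P_bcl" and "fractal_op I f B \<subseteq> B"
  shows "\<exists>a. \<forall>n. a \<in> cell f s B n"
proof -
  obtain M where M: "M \<in> P_bcl" "B \<subseteq> M" "fractal_op I f M \<subseteq> M"
    "(\<lambda>n. Max ((\<lambda>w. diameter (word_map f w ` M)) ` words n I)) \<longlonglongrightarrow> 0"
    using assms(1,3) unfolding diam_diminishing_def by blast
  have invM: "\<forall>i\<in>I. f i ` M \<subseteq> M"
    by (rule image_subset_if_fractal_op_subset[OF M(3)])
  have invB: "\<forall>i\<in>I. f i ` B \<subseteq> B"
    by (rule image_subset_if_fractal_op_subset[OF assms(4)])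
  have fin: "finite I" "bounded M"
    using assms(1) M(1) by (auto simp: diam_diminishing_def ifs_def P_bcl_def)
  have "\<exists>n. \<forall>x\<in>cell f s B n. \<forall>y\<in>cell f s B n. dist x y < e" if "e > 0" for e
    using cells_shrink[OF fin invM assms(2) M(4) that] cell_mono[OF M(2)] by (meson subsetD)
  moreover have "closed (cell f s B n)" for n
    by (simp add: cell_def)
  moreover have "cell f s B n \<noteq> {}" for n
    using assms(3) by (intro cell_nonempty) (simp add: P_bcl_def)
  ultimately obtain a where "\<And>n. a \<in> cell f s B n"
    using decreasing_closed_nest[of "cell f s B"] cell_antimono[OF invB assms(2)] by metis
  then show ?thesis by blast
qed

text \<open>
  The common point is the same for all invariant sets: the cells of \<open>B\<close> and of \<open>C\<close> lie in those
  of \<open>B \<union> C\<close>, which have at most one common point. Hence the description in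
  \<^const>\<open>code_point\<close> is satisfied by one point and, since \<open>B\<close> is an instance of it, by only one.
\<close>

lemma Inter_cells_eq_code_point:
  assumes "diam_diminishing I f" and "s \<in> streams I"
    and "B \<in> P_bcl" and "fractal_op I f B \<subseteq> B"
  shows "(\<Inter>n\<in>{1..}. cell f s B n) = {code_point I f s}"
proof -
  obtain a where a: "\<And>n. a \<in> cell f s B n"
    using ex_common_point_of_cells[OF assms] by blast
  have cells: "(\<Inter>n\<in>{1..}. cell f s C n) = {a}"
    if C: "C \<in> P_bcl" "fractal_op I f C \<subseteq> C" for C
  proof -
    obtain c where c: "\<And>n. c \<in> cell f s C n"
      using ex_common_point_of_cells[OF assms(1,2) C] by blast
    have union: "B \<union> C \<in> P_bcl"
      using assms(3) C(1) by (auto simp: P_bcl_def)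
    have "c = a"
    proof (rule common_point_of_cells_unique[OF assms(1,2) union])
      show "c \<in> cell f s (B \<union> C) n" for n
        using c cell_mono[of C "B \<union> C" f s n] by blast
      show "a \<in> cell f s (B \<union> C) n" for n
        using a cell_mono[of B "B \<union> C" f s n] by blast
    qed
    with c have aC: "a \<in> cell f s C n" for n by blast
    have "x = a" if "x \<in> (\<Inter>n\<in>{1..}. cell f s C n)" for x
      using that by (intro common_point_of_cells_unique[OF assms(1,2) C(1) _ aC]) simp
    with aC show ?thesis by blast
  qed
  have "code_point I f s = a"
    unfolding code_point_def
  proof (rule the_equality)
    show "\<forall>C\<in>P_bcl. fractal_op I f C \<subseteq> C \<longrightarrow>
        (\<Inter>n\<in>{1..}. closure (word_map f (stake n s) ` C)) = {a}"
      using cells by (simp add: cell_def)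
  next
    fix b
    assume "\<forall>C\<in>P_bcl. fractal_op I f C \<subseteq> C \<longrightarrow>
        (\<Inter>n\<in>{1..}. closure (word_map f (stake n s) ` C)) = {b}"
    then have "(\<Inter>n\<in>{1..}. cell f s B n) = {b}"
      using assms(3,4) by (simp add: cell_def)
    then show "b = a" using cells[OF assms(3,4)] by simp
  qed
  then show ?thesis using cells[OF assms(3,4)] by simp
qed

section \<open>Periodic words and fixed points\<close>

lemma stake_cycle_append:
  assumes "w \<noteq> []"
  shows "stake (length w + n) (cycle w) = w @ stake n (cycle w)"
  using stake_add[of "length w" "cycle w" n] assms by simp

text \<open>A continuous map sends a closure into the closure of the image.\<close>

lemma word_map_image_cell_subset:
  assumes "ifs I f" and "w \<in> lists I" and "w \<noteq> []"
  shows "word_map f w ` cell f (cycle w) B n \<subseteq> cell f (cycle w) B (length w + n)"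
proof -
  have "word_map f w ` closure (word_map f (stake n (cycle w)) ` B)
      \<subseteq> closure (word_map f w ` word_map f (stake n (cycle w)) ` B)"
    using continuous_on_word_map[OF assms(1,2)]
    by (intro continuous_image_closure_subset[of UNIV]) auto
  then show ?thesis
    unfolding cell_def stake_cycle_append[OF assms(3)] word_map_append by (simp add: image_comp)
qed

lemma fixed_point_in_cell:
  assumes "word_map f w x = x" and "w \<noteq> []" and "x \<in> B"
  shows "x \<in> cell f (cycle w) B (k * length w)"
proof -
  have "word_map f (stake (k * length w) (cycle w)) x = x"
  proof (induction k)
    case 0
    show ?case by simp
  next
    case (Suc k)
    have "stake (Suc k * length w) (cycle w) = w @ stake (k * length w) (cycle w)"
      using stake_cycle_append[OF assms(2), of "k * length w"] by simp
    then show ?case using Suc assms(1) by (simp add: word_map_append)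
  qed
  with assms(3) have "x \<in> word_map f (stake (k * length w) (cycle w)) ` B"
    by (metis imageI)
  then show ?thesis
    unfolding cell_def by (rule subsetD[OF closure_subset])
qed

theorem proposition3p6:
  fixes I :: "'i set" and f :: "'i \<Rightarrow> 'a::complete_space \<Rightarrow> 'a" and w :: "'i list"
  assumes "diam_diminishing I f"
    and "w \<in> lists I - {[]}"
  shows "{code_point I f (cycle w)} = Fix (word_map f w)"
proof -
  have w: "w \<in> lists I" "w \<noteq> []" using assms(2) by auto
  have s: "cycle w \<in> streams I"
    using w by (auto simp: streams_iff_sset)
  have ifs: "ifs I f" using assms(1) by (simp add: diam_diminishing_def)
  let ?a = "code_point I f (cycle w)"
  have invariant_superset: "\<exists>M\<in>P_bcl. x \<in> M \<and> fractal_op I f M \<subseteq> M" for x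
  proof -
    have "{x} \<in> P_bcl" by (simp add: P_bcl_def)
    then show ?thesis using assms(1) unfolding diam_diminishing_def by blast
  qed
  have antimono: "cell f (cycle w) M n \<subseteq> cell f (cycle w) M m"
    if "fractal_op I f M \<subseteq> M" "m \<le> n" for M m n
    by (rule cell_antimono[OF image_subset_if_fractal_op_subset[OF that(1)] s that(2)])
  have "word_map f w ?a = ?a"
  proof -
    obtain M where M: "M \<in> P_bcl" "fractal_op I f M \<subseteq> M"
      using invariant_superset by blast
    note Inter = Inter_cells_eq_code_point[OF assms(1) s M]
    have "word_map f w ?a \<in> cell f (cycle w) M n" if "n \<ge> 1" for n
    proof -
      have "?a \<in> cell f (cycle w) M n" using Inter that by blast
      then have "word_map f w ?a \<in> cell f (cycle w) M (length w + n)"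
        using word_map_image_cell_subset[OF ifs w] by blast
      then show ?thesis using antimono[OF M(2), of n "length w + n"] by auto
    qed
    then show ?thesis using Inter by blast
  qed
  moreover have "x = ?a" if "word_map f w x = x" for x
  proof -
    obtain M where M: "M \<in> P_bcl" "fractal_op I f M \<subseteq> M" and "x \<in> M"
      using invariant_superset by blast
    have "x \<in> cell f (cycle w) M n" for n
    proof -
      have "n \<le> n * length w" using w(2) by (simp add: Suc_le_eq)
      with fixed_point_in_cell[OF that w(2) \<open>x \<in> M\<close>] antimono[OF M(2)] show ?thesis by blast
    qed
    then show ?thesis using Inter_cells_eq_code_point[OF assms(1) s M] by blast
  qed
  ultimately show ?thesis unfolding Fix_def by blast
qed

end
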